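(* Let $I\subseteq\mathbb{R}$ be a nonempty open interval and let $f,g:I\to\mathbb{R}$ be continuous functions which are strictly monotone in the same sense. Then the Matkowski mean $\mathscr{M}_{f,g}$ enjoys the balancing property if and only if it is the quasi-arithmetic mean generated by the function $f+g$, that is, $\mathscr{M}_{f,g}=\mathscr{A}_{f+g}$ on $I\times I$.
   Context: "Strictly monotone in the same sense" means that $f$ and $g$ are both strictly increasing or both strictly decreasing. For such continuous $f,g:I\to\mathbb{R}$, the Matkowski mean generated by $(f,g)$ is $\mathscr{M}_{f,g}(x,y):=(f+g)^{-1}\big(f(x)+g(y)\big)$, $x,y\in I$. For a continuous, strictly monotone function $\varphi:I\to\mathbb{R}$, the quasi-arithmetic mean generated by $\varphi$ is $\mathscr{A}_\varphi(x,y):=\varphi^{-1}\big(\tfrac{\varphi(x)+\varphi(y)}{2}\big)$, $x,y\in I$. A mean on $I$ is a function $M:I\times I\to\mathbb{R}$ with $\min(x,y)\le M(x,y)\le\max(x,y)$ for all $x,y\in I$. It has the balancing property if $M\big(M(x,M(x,y)),M(M(x,y),y)\big)=M(x,y)$ for all $x,y\in I$. *)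

theory Defs
  imports "HOL-Analysis.Analysis"
begin

definition strictly_monotone_same_sense :: "real set \<Rightarrow> (real \<Rightarrow> real) \<Rightarrow> (real \<Rightarrow> real) \<Rightarrow> bool" where
  "strictly_monotone_same_sense I f g \<longleftrightarrow>
     (strict_mono_on I f \<and> strict_mono_on I g) \<or>
     (strict_antimono_on I f \<and> strict_antimono_on I g)"

(* Functions on I are represented by total functions of which only the values on I matter;
   accordingly, inverses are those of the restrictions to I. *)

definition matkowski_mean ::
    "real set \<Rightarrow> (real \<Rightarrow> real) \<Rightarrow> (real \<Rightarrow> real) \<Rightarrow> real \<Rightarrow> real \<Rightarrow> real" where
  "matkowski_mean I f g x y = inv_into I (\<lambda>t. f t + g t) (f x + g y)"

definition quasi_arithmetic_mean ::
    "real set \<Rightarrow> (real \<Rightarrow> real) \<Rightarrow> real \<Rightarrow> real \<Rightarrow> real" where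
  "quasi_arithmetic_mean I \<phi> x y = inv_into I \<phi> ((\<phi> x + \<phi> y) / 2)"

definition mean_on :: "real set \<Rightarrow> (real \<Rightarrow> real \<Rightarrow> real) \<Rightarrow> bool" where
  "mean_on I M \<longleftrightarrow> (\<forall>x\<in>I. \<forall>y\<in>I. min x y \<le> M x y \<and> M x y \<le> max x y)"

(* Intended for means on I: on an interval these map I \<times> I into I, so that the nested
   applications only involve values of M on I \<times> I. *)
definition balancing_on :: "real set \<Rightarrow> (real \<Rightarrow> real \<Rightarrow> real) \<Rightarrow> bool" where
  "balancing_on I M \<longleftrightarrow> (\<forall>x\<in>I. \<forall>y\<in>I. M (M x (M x y)) (M (M x y) y) = M x y)"

(* The lemmas below show that f x + g y and (\<phi> x + \<phi> y) / 2 are attained on I by f + g and \<phi>,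
   respectively, so that inv_into is never applied outside the range. *)

lemma ivt_between:
  fixes h :: "real \<Rightarrow> real"
  assumes "is_interval I" "continuous_on I h" "x \<in> I" "y \<in> I"
    and "min (h x) (h y) \<le> c" "c \<le> max (h x) (h y)"
  obtains t where "t \<in> I" "min x y \<le> t" "t \<le> max x y" "h t = c"
proof -
  have sub: "closed_segment x y \<subseteq> I"
    using assms(1,3,4) by (simp add: closed_segment_subset is_interval_convex)
  have "connected (h ` closed_segment x y)"
    by (intro connected_continuous_image continuous_on_subset[OF assms(2) sub]) simp
  moreover have "h x \<in> h ` closed_segment x y" "h y \<in> h ` closed_segment x y" by auto
  ultimately have "c \<in> h ` closed_segment x y"
    using assms(5,6) by (auto simp: min_def max_def split: if_splits dest: connectedD_interval)
  then obtain t where "t \<in> closed_segment x y" "h t = c" by auto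
  with sub show ?thesis
    by (intro that[of t]) (auto simp: closed_segment_eq_real_ivl split: if_splits)
qed

lemma mean_on_matkowski_mean:
  assumes "is_interval I" "continuous_on I f" "continuous_on I g"
    and "strictly_monotone_same_sense I f g"
  shows "mean_on I (matkowski_mean I f g)"
  unfolding mean_on_def
proof (intro ballI)
  fix x y assume xy: "x \<in> I" "y \<in> I"
  let ?h = "\<lambda>t. f t + g t"
  have inj: "inj_on ?h I"
    using assms(4) unfolding strictly_monotone_same_sense_def inj_on_def monotone_on_def
    by (smt (verit))
  have "min (?h x) (?h y) \<le> f x + g y" "f x + g y \<le> max (?h x) (?h y)"
    using assms(4) xy unfolding strictly_monotone_same_sense_def monotone_on_def
    by (smt (verit))+
  then obtain t where "t \<in> I" "min x y \<le> t" "t \<le> max x y" "?h t = f x + g y"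
    using ivt_between[of I ?h x y "f x + g y"] assms xy by (auto intro: continuous_intros)
  then show "min x y \<le> matkowski_mean I f g x y \<and> matkowski_mean I f g x y \<le> max x y"
    using inv_into_f_f[OF inj, of t] by (simp add: matkowski_mean_def)
qed

lemma mean_on_quasi_arithmetic_mean:
  assumes "is_interval I" "continuous_on I \<phi>"
    and "strict_mono_on I \<phi> \<or> strict_antimono_on I \<phi>"
  shows "mean_on I (quasi_arithmetic_mean I \<phi>)"
  unfolding mean_on_def
proof (intro ballI)
  fix x y assume xy: "x \<in> I" "y \<in> I"
  have inj: "inj_on \<phi> I"
    using assms(3) unfolding inj_on_def monotone_on_def by (smt (verit))
  have "min (\<phi> x) (\<phi> y) \<le> (\<phi> x + \<phi> y) / 2" "(\<phi> x + \<phi> y) / 2 \<le> max (\<phi> x) (\<phi> y)"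
    by (simp_all add: min_def max_def)
  then obtain t where "t \<in> I" "min x y \<le> t" "t \<le> max x y" "\<phi> t = (\<phi> x + \<phi> y) / 2"
    using ivt_between[OF assms(1,2) xy] by blast
  then show "min x y \<le> quasi_arithmetic_mean I \<phi> x y \<and> quasi_arithmetic_mean I \<phi> x y \<le> max x y"
    unfolding quasi_arithmetic_mean_def using inv_into_f_f[OF inj, of t] by metis
qed

end

theory Submission
  imports Defs
begin

text \<open>
  Write \<open>h = f + g\<close> and \<open>M\<close> for the Matkowski mean. Since \<open>h\<close> is injective and \<open>f x + g y\<close> is one of
  its values, \<open>M x y\<close> is the unique \<open>t\<close> in \<open>I\<close> with \<open>h t = f x + g y\<close>. As
  \<open>f x + g y - (h x + h y) / 2 = ((f - g) x - (f - g) y) / 2\<close>, the mean \<open>M\<close> equals the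
  quasi-arithmetic mean of \<open>h\<close> exactly when \<open>f - g\<close> is constant, and the theorem says that
  balancing is equivalent to this.

  If \<open>f - g\<close> is constant, then \<open>h\<close> conjugates \<open>M\<close> to the arithmetic mean, which is balanced
  (\<open>balancing_if_difference_constant\<close>).

  Conversely, let \<open>M\<close> be balanced. In the balancing equation for \<open>u\<close>, \<open>v\<close> put \<open>w = M u v\<close>,
  \<open>q = M u w\<close> and \<open>p = M w v\<close>. Adding the defining equations of \<open>p\<close> and \<open>q\<close> gives
  \<open>h p + h q = 2 h w\<close>, and the balancing equation \<open>M q p = w\<close> reads \<open>f q + g p = h w\<close>. Together
  they say that \<open>f - g\<close> takes the same value at \<open>p\<close> and \<open>q\<close>. It remains to see which
  pairs \<open>p\<close>, \<open>q\<close> arise. Given \<open>p\<close> and \<open>q\<close>, the point \<open>w\<close> must be their quasi-arithmetic mean, and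
  then, with \<open>d = (h q - h p) / 2\<close>, the points \<open>u\<close> and \<open>v\<close> must solve \<open>f u = f w + d\<close> and
  \<open>g v = g w - d\<close>. Because \<open>I\<close> is open and \<open>f\<close>, \<open>g\<close> are continuous and strictly monotone, these
  equations are solvable as soon as \<open>p\<close> and \<open>q\<close> are close enough to a given point of \<open>I\<close>
  (\<open>difference_locally_constant\<close>). Hence \<open>f - g\<close> is locally constant, and it is constant because
  \<open>I\<close> is connected.
\<close>

locale matkowski_generators =
  fixes I :: "real set" and f g :: "real \<Rightarrow> real"
  assumes interval: "is_interval I"
    and cont_f: "continuous_on I f" and cont_g: "continuous_on I g"
    and mono: "strictly_monotone_same_sense I f g"
begin

abbreviation h :: "real \<Rightarrow> real" where "h \<equiv> \<lambda>t. f t + g t"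

abbreviation M :: "real \<Rightarrow> real \<Rightarrow> real" where "M \<equiv> matkowski_mean I f g"

abbreviation A :: "real \<Rightarrow> real \<Rightarrow> real" where "A \<equiv> quasi_arithmetic_mean I h"

lemma cont_h: "continuous_on I h"
  by (intro continuous_intros cont_f cont_g)

lemma inj_h: "inj_on h I"
  using mono unfolding strictly_monotone_same_sense_def inj_on_def monotone_on_def
  by (smt (verit))

lemma matkowski_mean_in_and_generator:
  assumes "x \<in> I" "y \<in> I"
  shows "M x y \<in> I" "h (M x y) = f x + g y"
proof -
  have "min (h x) (h y) \<le> f x + g y" "f x + g y \<le> max (h x) (h y)"
    using mono assms unfolding strictly_monotone_same_sense_def monotone_on_def
    by (smt (verit))+
  then obtain t where "t \<in> I" "h t = f x + g y"
    using ivt_between[OF interval cont_h assms] by blast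
  then have range: "f x + g y \<in> h ` I"
    by (intro image_eqI[of _ h t]) simp_all
  show "M x y \<in> I"
    unfolding matkowski_mean_def using range by (rule inv_into_into)
  show "h (M x y) = f x + g y"
    unfolding matkowski_mean_def using range by (rule f_inv_into_f[where f = h])
qed

lemma quasi_arithmetic_mean_in_and_generator:
  assumes "x \<in> I" "y \<in> I"
  shows "A x y \<in> I" "h (A x y) = (h x + h y) / 2"
proof -
  have "min (h x) (h y) \<le> (h x + h y) / 2" "(h x + h y) / 2 \<le> max (h x) (h y)"
    by (simp_all add: min_def max_def)
  then obtain t where "t \<in> I" "h t = (h x + h y) / 2"
    using ivt_between[OF interval cont_h assms] by blast
  then have range: "(h x + h y) / 2 \<in> h ` I"
    by (intro image_eqI[of _ h t]) simp_all
  show "A x y \<in> I"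
    unfolding quasi_arithmetic_mean_def using range by (rule inv_into_into)
  show "h (A x y) = (h x + h y) / 2"
    unfolding quasi_arithmetic_mean_def using range by (rule f_inv_into_f[where f = h])
qed

lemma matkowski_mean_eqI:
  assumes "t \<in> I" "h t = f x + g y"
  shows "M x y = t"
  using inv_into_f_f[OF inj_h assms(1)] assms(2) by (simp add: matkowski_mean_def)

lemma matkowski_eq_quasi_arithmetic_iff:
  assumes "x \<in> I" "y \<in> I"
  shows "M x y = A x y \<longleftrightarrow> f x - g x = f y - g y"
proof -
  have "M x y = A x y \<longleftrightarrow> h (M x y) = h (A x y)"
    using inj_on_eq_iff[OF inj_h matkowski_mean_in_and_generator(1)[OF assms]
        quasi_arithmetic_mean_in_and_generator(1)[OF assms]] by (rule sym)
  also have "\<dots> \<longleftrightarrow> f x - g x = f y - g y"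
    using matkowski_mean_in_and_generator(2)[OF assms]
      quasi_arithmetic_mean_in_and_generator(2)[OF assms] by (auto simp: field_simps)
  finally show ?thesis .
qed

lemma balancing_if_difference_constant:
  assumes const: "\<And>x y. x \<in> I \<Longrightarrow> y \<in> I \<Longrightarrow> f x - g x = f y - g y"
  shows "balancing_on I M"
  unfolding balancing_on_def
proof (intro ballI)
  fix x y assume xy: "x \<in> I" "y \<in> I"
  have mid: "h (M s t) = (h s + h t) / 2" if "s \<in> I" "t \<in> I" for s t
    using matkowski_mean_in_and_generator(2)[OF that] const[OF that] by (simp add: field_simps)
  note inI = matkowski_mean_in_and_generator(1)
  let ?w = "M x y"
  have w: "?w \<in> I" and a: "M x ?w \<in> I" and b: "M ?w y \<in> I"
    using inI xy by blast+
  have "h (M (M x ?w) (M ?w y)) = (h x + h y + 2 * h ?w) / 4"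
    using mid[OF a b] mid[OF xy(1) w] mid[OF w xy(2)] by (simp add: field_simps)
  also have "\<dots> = h ?w"
    using mid[OF xy] by (simp add: field_simps)
  finally show "M (M x ?w) (M ?w y) = ?w"
    by (rule inj_onD[OF inj_h _ inI[OF a b] w])
qed

text \<open>
  The points \<open>u\<close> and \<open>v\<close> are chosen so that the inner means in the balancing equation come out
  as the prescribed \<open>p\<close> and \<open>q\<close>, with the quasi-arithmetic mean \<open>w\<close> of \<open>p\<close> and \<open>q\<close> as \<open>M u v\<close>.
\<close>

lemma balancing_imp_difference_eq:
  assumes bal: "balancing_on I M"
    and I: "p \<in> I" "q \<in> I" "w \<in> I" "u \<in> I" "v \<in> I"
    and w: "h w = (h p + h q) / 2"
    and u: "f u = f w + (h q - h p) / 2"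
    and v: "g v = g w - (h q - h p) / 2"
  shows "f p - g p = f q - g q"
proof -
  have uv: "M u v = w"
    using I(3) by (rule matkowski_mean_eqI) (simp add: u v)
  have uw: "M u w = q"
    using I(2) by (rule matkowski_mean_eqI) (use u w in argo)
  have wv: "M w v = p"
    using I(1) by (rule matkowski_mean_eqI) (use v w in argo)
  have "M q p = w"
    using bal I(4,5) uv uw wv unfolding balancing_on_def by metis
  then have "f q + g p = h w"
    using matkowski_mean_in_and_generator(2)[OF I(2,1)] by simp
  with w show ?thesis by argo
qed

text \<open>
  Around an interior point \<open>x\<close> the values \<open>f x\<close> and \<open>g x\<close> are interior to the ranges of \<open>f\<close> and
  \<open>g\<close>, which leaves room for the perturbations that define \<open>u\<close> and \<open>v\<close>.
\<close>

lemma difference_locally_constant: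
  assumes bal: "balancing_on I M" and "open I" and x: "x \<in> I"
  obtains \<delta> where "\<delta> > 0"
    "\<And>p q. p \<in> I \<Longrightarrow> q \<in> I \<Longrightarrow> \<bar>p - x\<bar> < \<delta> \<Longrightarrow> \<bar>q - x\<bar> < \<delta> \<Longrightarrow> f p - g p = f q - g q"
proof -
  obtain r where r: "r > 0" "cball x r \<subseteq> I"
    using \<open>open I\<close> x open_contains_cball by blast
  define a b where "a = x - r" and "b = x + r"
  have ab: "a \<in> I" "b \<in> I" "a < x" "x < b"
    using r by (auto simp: a_def b_def dist_real_def)
  have strict: "min (f a) (f b) < f x" "f x < max (f a) (f b)"
      "min (g a) (g b) < g x" "g x < max (g a) (g b)"
    using mono ab x unfolding strictly_monotone_same_sense_def monotone_on_def
    by (smt (verit))+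
  \<comment> \<open>The factor 3: when \<open>f\<close> and \<open>g\<close> stay within \<open>\<epsilon>\<close> of their values at \<open>x\<close>, the value
    \<open>f w + (h q - h p) / 2\<close> is off from \<open>f x\<close> by less than \<open>3 * \<epsilon>\<close>, of which \<open>\<epsilon>\<close> is due to \<open>f w\<close>
    and \<open>2 * \<epsilon>\<close> to the half difference of \<open>h = f + g\<close>; likewise for \<open>g\<close>.\<close>
  define S where "S = {f x - min (f a) (f b), max (f a) (f b) - f x,
      g x - min (g a) (g b), max (g a) (g b) - g x}"
  have S: "finite S" "S \<noteq> {}"
    by (simp_all add: S_def)
  define \<epsilon> where "\<epsilon> = Min S / 3"
  have "\<forall>e\<in>S. e > 0"
    using strict by (simp add: S_def)
  then have "\<epsilon> > 0"
    using Min_in[OF S] by (simp add: \<epsilon>_def)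
  have le: "3 * \<epsilon> \<le> e" if "e \<in> S" for e
    using Min_le[OF S(1) that] by (simp add: \<epsilon>_def)
  have room: "3 * \<epsilon> \<le> f x - min (f a) (f b)" "3 * \<epsilon> \<le> max (f a) (f b) - f x"
      "3 * \<epsilon> \<le> g x - min (g a) (g b)" "3 * \<epsilon> \<le> max (g a) (g b) - g x"
    by (rule le, simp add: S_def)+
  obtain \<delta>1 where \<delta>1: "\<delta>1 > 0" "\<And>z. z \<in> I \<Longrightarrow> \<bar>z - x\<bar> < \<delta>1 \<Longrightarrow> \<bar>f z - f x\<bar> < \<epsilon>"
    using cont_f x \<open>\<epsilon> > 0\<close> unfolding continuous_on_iff dist_real_def by metis
  obtain \<delta>2 where \<delta>2: "\<delta>2 > 0" "\<And>z. z \<in> I \<Longrightarrow> \<bar>z - x\<bar> < \<delta>2 \<Longrightarrow> \<bar>g z - g x\<bar> < \<epsilon>"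
    using cont_g x \<open>\<epsilon> > 0\<close> unfolding continuous_on_iff dist_real_def by metis
  define \<delta> where "\<delta> = min \<delta>1 \<delta>2"
  have near: "\<bar>f z - f x\<bar> < \<epsilon>" "\<bar>g z - g x\<bar> < \<epsilon>" if "z \<in> I" "\<bar>z - x\<bar> < \<delta>" for z
    using \<delta>1(2) \<delta>2(2) that by (auto simp: \<delta>_def)
  show ?thesis
  proof (rule that)
    show "\<delta> > 0"
      using \<delta>1 \<delta>2 by (simp add: \<delta>_def)
    fix p q assume p: "p \<in> I" "\<bar>p - x\<bar> < \<delta>" and q: "q \<in> I" "\<bar>q - x\<bar> < \<delta>"
    have "min (h p) (h q) \<le> (h p + h q) / 2" "(h p + h q) / 2 \<le> max (h p) (h q)"
      by (simp_all add: min_def max_def)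
    then obtain w where w: "w \<in> I" "min p q \<le> w" "w \<le> max p q" "h w = (h p + h q) / 2"
      using ivt_between[OF interval cont_h p(1) q(1)] by blast
    define d where "d = (h q - h p) / 2"
    have d: "\<bar>d\<bar> < 2 * \<epsilon>"
      using near[OF p] near[OF q] unfolding d_def abs_less_iff by argo
    have "\<bar>w - x\<bar> < \<delta>"
      using w(2,3) p(2) q(2) by (auto simp: min_def max_def abs_less_iff split: if_splits)
    note near_w = near[OF w(1) this]
    have "min (f a) (f b) \<le> f w + d" "f w + d \<le> max (f a) (f b)"
      using room(1,2) near_w(1) d unfolding abs_less_iff by argo+
    then obtain u where u: "u \<in> I" "f u = f w + d"
      using ivt_between[OF interval cont_f ab(1,2)] by blast
    have "min (g a) (g b) \<le> g w - d" "g w - d \<le> max (g a) (g b)"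
      using room(3,4) near_w(2) d unfolding abs_less_iff by argo+
    then obtain v where v: "v \<in> I" "g v = g w - d"
      using ivt_between[OF interval cont_g ab(1,2)] by blast
    show "f p - g p = f q - g q"
      using balancing_imp_difference_eq[OF bal p(1) q(1) w(1) u(1) v(1) w(4)]
        u(2) v(2) d_def by simp
  qed
qed

lemma balancing_imp_difference_constant:
  assumes bal: "balancing_on I M" and "open I" and "x \<in> I" "y \<in> I"
  shows "f x - g x = f y - g y"
proof (rule connected_local_const[OF _ assms(3,4), where f = "\<lambda>t. f t - g t"])
  show "connected I"
    using interval by (simp add: is_interval_connected)
  show "\<forall>c\<in>I. \<forall>\<^sub>F t in at c within I. f c - g c = f t - g t"
  proof
    fix c assume c: "c \<in> I"
    obtain \<delta> where \<delta>: "\<delta> > 0"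
      "\<And>p q. p \<in> I \<Longrightarrow> q \<in> I \<Longrightarrow> \<bar>p - c\<bar> < \<delta> \<Longrightarrow> \<bar>q - c\<bar> < \<delta> \<Longrightarrow> f p - g p = f q - g q"
      using difference_locally_constant[OF bal \<open>open I\<close> c] by blast
    have "f c - g c = f t - g t" if "t \<in> I" "dist t c < \<delta>" for t
      by (rule \<delta>(2)) (use that c \<delta>(1) in \<open>simp_all add: dist_real_def\<close>)
    then show "\<forall>\<^sub>F t in at c within I. f c - g c = f t - g t"
      unfolding eventually_at using \<delta>(1) by blast
  qed
qed

end

theorem corollary11:
  fixes I :: "real set" and f g :: "real \<Rightarrow> real"
  assumes "open I" and "is_interval I" and "I \<noteq> {}"
    and "continuous_on I f" and "continuous_on I g"
    and "strictly_monotone_same_sense I f g"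
  shows "balancing_on I (matkowski_mean I f g) \<longleftrightarrow>
    (\<forall>x\<in>I. \<forall>y\<in>I. matkowski_mean I f g x y = quasi_arithmetic_mean I (\<lambda>t. f t + g t) x y)"
proof -
  interpret matkowski_generators I f g
    using assms by unfold_locales
  show ?thesis
    using balancing_imp_difference_constant[OF _ \<open>open I\<close>] balancing_if_difference_constant
      matkowski_eq_quasi_arithmetic_iff by blast
qed

end
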